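(* Let $\rho\in(0,1)$, let $\widehat F$ be the integrated tail distribution of a nonnegative distribution $F$ with finite positive mean, and let $G_m\sim\mathrm{Erlang}(\xi(m),\xi(m))$ with $\xi(m)\in\mathbb{N}$. Let $\{\mathcal{A}_k\}_{k\ge0}$ be a decreasing sequence of closed intervals $\mathcal{A}_k=[a_k,b_k]$, $\mathcal{A}_{k+1}\subset\mathcal{A}_k$, with $\mathcal{A}_0=[0,\infty]$ and $\mathcal{A}_k\searrow\{1\}$. Then for every $u>0$ $$\left|\psi_{\widehat F}(u)-\psi_{\widehat F\star G_m}(u)\right|\le\frac{\rho}{1-\rho\widehat F(u)}\sum_{k=0}^\infty\ \sup_{\ell<u}\big(\widehat F_{a_k}(\ell)-\widehat F_{b_k}(\ell)\big)\big(G_m(\mathcal{A}_k)-G_m(\mathcal{A}_{k+1})\big).$$ Moreover, if $\widehat F$ is absolutely continuous with bounded density, then $\psi_{\widehat F\star G_m}(u)\to\psi_{\widehat F}(u)$ uniformly in $u$ as $\xi(m)\to\infty$.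
   Context: The integrated tail of $F$ with mean $\mu_F$ is $\widehat F(u)=\mu_F^{-1}\int_0^u(1-F(t))\,dt$. $\mathrm{Erlang}(k,k)$ is the Gamma distribution with shape $k$ and rate $k$. $\widehat F\star G(u)=\int_0^\infty\widehat F(u/s)\,dG(s)$. For a distribution $H$ on $[0,\infty)$, $\psi_H(u):=(1-\rho)\sum_{n=1}^\infty\rho^n(1-H^{*n}(u))$, with $H^{*n}$ the $n$-fold additive convolution. $\widehat F_s(\ell):=\widehat F(\ell/s)$ for $\ell>0$, with $\widehat F_0(\ell)=1$ and $\widehat F_\infty(\ell)=0$; the suprema over $\ell<u$ are over $0<\ell<u$. $G_m(\mathcal{A}_k):=G_m(b_k)-G_m(a_k)$, with $G_m(\infty)=1$. $\mathcal{A}_k\searrow\{1\}$ means $\bigcap_k\mathcal{A}_k=\{1\}$. *)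

theory Defs
  imports "HOL-Probability.Probability"
begin

text \<open>Distributions are identified with their distribution functions. Where the law itself is
  needed, it is the Lebesgue--Stieltjes measure \<^const>\<open>interval_measure\<close> of the function.\<close>

definition mean :: "real measure \<Rightarrow> real" where
  "mean F = (\<integral>x. x \<partial>F)"

text \<open>For \<open>u < 0\<close> the domain of integration is empty, so the value is 0.\<close>

definition integrated_tail :: "real measure \<Rightarrow> real \<Rightarrow> real" where
  "integrated_tail F u = (LBINT t:{0..u}. 1 - cdf F t) / mean F"

text \<open>The library's \<^const>\<open>erlang_density\<close> with first argument \<open>j\<close> is the Gamma density of
  shape \<open>j + 1\<close>, hence the shift; only \<open>n \<ge> 1\<close> is meaningful.\<close>

definition Erlang :: "nat \<Rightarrow> real measure" where
  "Erlang n = density lborel (\<lambda>x. ennreal (erlang_density (n - 1) (real n) x))"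

text \<open>\<open>H \<star> G\<close>, the distribution function of a product of independent variables with laws \<open>H\<close>
  and \<open>G\<close>. The point \<open>s = 0\<close> is left out, as \<open>H (u / s)\<close> is undefined there; for \<open>G\<close> without
  an atom at 0 (such as Erlang laws) this makes no difference.\<close>

definition mellin_conv :: "(real \<Rightarrow> real) \<Rightarrow> real measure \<Rightarrow> real \<Rightarrow> real" where
  "mellin_conv H G u = (LINT s:{0<..}|G. H (u / s))"

primrec conv_power :: "real measure \<Rightarrow> nat \<Rightarrow> real measure" where
  "conv_power M 0 = return borel 0"
| "conv_power M (Suc n) = convolution M (conv_power M n)"

text \<open>The defining series starts at \<open>n = 1\<close>, hence \<^const>\<open>Suc\<close>.\<close>

definition psi :: "real \<Rightarrow> (real \<Rightarrow> real) \<Rightarrow> real \<Rightarrow> real" where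
  "psi \<rho> H u =
     (1 - \<rho>) * (\<Sum>n. \<rho> ^ Suc n * (1 - cdf (conv_power (interval_measure H) (Suc n)) u))"

text \<open>\<open>H\<^sub>s(l) = H(l/s)\<close> for \<open>l > 0\<close> and \<open>s \<in> [0,\<infinity>]\<close>, with \<open>H\<^sub>0 = 1\<close> and \<open>H\<^sub>\<infinity> = 0\<close>.\<close>

definition scaled :: "(real \<Rightarrow> real) \<Rightarrow> ereal \<Rightarrow> real \<Rightarrow> real" where
  "scaled H s l =
     (if s = 0 then 1 else if s = \<infinity> then 0 else H (l / real_of_ereal s))"

definition cdf_ext :: "real measure \<Rightarrow> ereal \<Rightarrow> real" where
  "cdf_ext G x = (if x = \<infinity> then 1 else cdf G (real_of_ereal x))"

text \<open>The mass \<open>G(b) - G(a)\<close> assigned to the interval \<open>[a,b]\<close>.\<close>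

definition interval_mass :: "real measure \<Rightarrow> ereal \<Rightarrow> ereal \<Rightarrow> real" where
  "interval_mass G a b = cdf_ext G b - cdf_ext G a"

definition shrinks_to_one :: "(nat \<Rightarrow> ereal) \<Rightarrow> (nat \<Rightarrow> ereal) \<Rightarrow> bool" where
  "shrinks_to_one a b \<longleftrightarrow>
     a 0 = 0 \<and> b 0 = \<infinity> \<and> (\<forall>k. {a (Suc k)..b (Suc k)} \<subseteq> {a k..b k}) \<and>
     (\<Inter>k. {a k..b k}) = {1}"

definition ac_bounded_density :: "(real \<Rightarrow> real) \<Rightarrow> bool" where
  "ac_bounded_density H \<longleftrightarrow>
     (\<exists>f C. f \<in> borel_measurable borel \<and> (\<forall>x. 0 \<le> f x \<and> f x \<le> C) \<and>
       interval_measure H = density lborel (\<lambda>x. ennreal (f x)))"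

end

theory Submission
  imports Defs
begin

text \<open>If \<open>\<bar>H - H'\<bar> \<le> d\<close> on \<open>[0,u]\<close>, then writing
  \<open>H * P - H' * P' = H * (P - P') + (H - H') * P'\<close> with \<open>P = H\<^sup>*\<^sup>n\<close>, \<open>P' = H'\<^sup>*\<^sup>n\<close> gives a bound \<open>e\<^sub>n\<close>
  for the distance of the \<open>n\<close>-fold convolutions on \<open>[0,u]\<close> with \<open>e\<^sub>n\<^sub>+\<^sub>1 = H(u) e\<^sub>n + d\<close>; summing
  geometrically, the two values of \<open>psi\<close> at \<open>u\<close> differ by at most \<open>\<rho> d / (1 - \<rho> H(u))\<close>.
  For \<open>H' = H \<star> G\<close> one has \<open>H(l) - H'(l) = \<integral> (H(l) - H(l/s)) dG(s)\<close>, and monotonicity bounds the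
  integrand on the \<open>k\<close>-th shell \<open>[a\<^sub>k,b\<^sub>k] - [a\<^sub>k\<^sub>+\<^sub>1,b\<^sub>k\<^sub>+\<^sub>1]\<close>, as
  \<open>[a\<^sub>k,b\<^sub>k]\<close> contains both \<open>s\<close> and \<open>1\<close>; this gives the series as \<open>d\<close>. An integrated tail is Lipschitz with constant
  \<open>1 / mean F\<close>, so the integrand is small for \<open>s\<close> near \<open>1\<close>, uniformly in \<open>l\<close>, and the variance
  \<open>1 / n\<close> of the Erlang law makes \<open>d\<close> small on the whole half-line.\<close>

section \<open>Stability of geometric compounds\<close>

text \<open>Contains both an integrated tail and its products with a positive factor. Continuity
  makes \<open>interval_measure H\<close> a law with distribution function \<open>H\<close>, and
  lets bounds on an open interval extend to its end points.\<close>

locale continuous_life_cdf =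
  fixes H :: "real \<Rightarrow> real"
  assumes mono_H: "mono H"
    and cont_H: "\<And>x. isCont H x"
    and H_nonpos: "\<And>x. x \<le> 0 \<Longrightarrow> H x = 0"
    and H_lim: "(H \<longlongrightarrow> 1) at_top"
begin

lemma H_nonneg: "0 \<le> H x"
  by (metis H_nonpos linear mono_H monoD order_refl)

lemma H_le_1: "H x \<le> 1"
  by (rule tendsto_lowerbound[OF H_lim])
     (auto simp: eventually_at_top_linorder intro!: exI[of _ x] monoD[OF mono_H])

lemma abs_H_diff_le_1: "\<bar>H x - H y\<bar> \<le> 1"
  using H_nonneg[of x] H_nonneg[of y] H_le_1[of x] H_le_1[of y] by linarith

lemma H_bot: "(H \<longlongrightarrow> 0) at_bot"
  by (rule tendsto_eventually) (auto simp: eventually_at_bot_linorder intro!: exI[of _ 0] H_nonpos)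

lemma cdf_H: "cdf (interval_measure H) = H"
  by (intro cdf_interval_measure monoD[OF mono_H] H_bot)
     (auto intro: continuous_at_imp_continuous_at_within cont_H)

lemma H_borel [measurable]: "H \<in> borel_measurable borel"
  using mono_H by (rule borel_measurable_mono)

end

sublocale continuous_life_cdf \<subseteq> law: real_distribution "interval_measure H"
  by (intro real_distribution_interval_measure monoD[OF mono_H] H_bot H_lim)
     (auto intro: continuous_at_imp_continuous_at_within cont_H)

section \<open>Convolutions and their distribution functions\<close>

lemma (in real_distribution) conv_power_real_distribution:
  "real_distribution (conv_power M n)"
proof (induction n)
  case 0
  show ?case
    by (auto simp: real_distribution_def real_distribution_axioms_def intro!: prob_space_return)
next
  case (Suc n)
  then interpret N: real_distribution "conv_power M n" .
  interpret P: pair_prob_space M "conv_power M n" ..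
  have [measurable_cong]: "sets M = sets borel" "sets (conv_power M n) = sets borel"
    by (auto simp: M_is_borel N.M_is_borel)
  have "prob_space (convolution M (conv_power M n))"
    unfolding convolution_def by (rule P.prob_space_distr) simp
  then show ?case
    by (auto simp: real_distribution_def real_distribution_axioms_def)
qed

lemma (in real_distribution) cdf_integrable_reflect:
  assumes "real_distribution N"
  shows "integrable M (\<lambda>x. cdf N (l - x))"
proof -
  interpret N: real_distribution N by fact
  have "cdf N \<in> borel_measurable borel"
    by (rule borel_measurable_mono) (auto intro!: monoI N.cdf_nondecreasing)
  then have "(\<lambda>x. cdf N (l - x)) \<in> borel_measurable M"
    by measurable
  then show ?thesis
    by (rule integrable_const_bound[where B=1, rotated])
       (auto simp: N.cdf_nonneg N.cdf_bounded_prob)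
qed

lemma cdf_convolution:
  assumes "real_distribution M" "real_distribution N"
  shows "cdf (convolution M N) l = (\<integral>x. cdf N (l - x) \<partial>M)"
proof -
  interpret M: real_distribution M by fact
  interpret N: real_distribution N by fact
  interpret C: finite_measure "convolution M N"
    by (intro convolution_finite M.finite_measure_axioms N.finite_measure_axioms)
       (auto simp: M.M_is_borel N.M_is_borel)
  have "ennreal (cdf (convolution M N) l) = emeasure (convolution M N) {..l}"
    by (simp add: cdf_def C.emeasure_eq_measure)
  also have "\<dots> = (\<integral>\<^sup>+x. emeasure N {a. a + x \<in> {..l}} \<partial>M)"
    by (rule convolution_emeasure)
       (auto simp: M.M_is_borel N.M_is_borel M.finite_measure_axioms N.finite_measure_axioms)
  also have "\<dots> = (\<integral>\<^sup>+x. ennreal (cdf N (l - x)) \<partial>M)"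
    by (intro nn_integral_cong)
       (auto simp: cdf_def N.emeasure_eq_measure algebra_simps intro!: arg_cong[where f="measure N"])
  also have "\<dots> = ennreal (\<integral>x. cdf N (l - x) \<partial>M)"
    by (intro nn_integral_eq_integral M.cdf_integrable_reflect assms) (auto simp: N.cdf_nonneg)
  finally show ?thesis
    by (subst (asm) ennreal_inj) (auto simp: cdf_def intro!: Bochner_Integration.integral_nonneg)
qed

text \<open>Conditioning on the second summand, by commutativity. The stability estimate needs both
  forms.\<close>

lemma cdf_convolution':
  assumes "real_distribution M" "real_distribution N"
  shows "cdf (convolution M N) l = (\<integral>x. cdf M (l - x) \<partial>N)"
proof -
  interpret M: real_distribution M by fact
  interpret N: real_distribution N by fact
  have "convolution M N = convolution N M"
    by (intro convolution_commutative M.finite_measure_axioms N.finite_measure_axioms)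
       (auto simp: M.M_is_borel N.M_is_borel)
  then show ?thesis
    by (simp add: cdf_convolution assms)
qed

text \<open>The mass of the open negative half-line is the left limit of the distribution function
  at 0. The almost sure form serves under integrals, the other form at negative arguments
  \<open>l - x\<close>.\<close>

lemma (in real_distribution) AE_nonneg_iff:
  "(AE x in M. 0 \<le> x) \<longleftrightarrow> (\<forall>x<0. cdf M x = 0)"
proof safe
  fix x :: real assume "AE x in M. 0 \<le> x" "x < 0"
  then have "{..x} \<in> null_sets M"
    by (subst AE_iff_null_sets) (auto simp: M_is_borel elim!: eventually_mono)
  then show "cdf M x = 0"
    by (simp add: cdf_def null_setsD1 measure_def)
next
  assume "\<forall>x<0. cdf M x = 0"
  then have "(cdf M \<longlongrightarrow> 0) (at_left 0)"
    by (intro tendsto_eventually) (auto simp: eventually_at_filter intro!: always_eventually)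
  with cdf_at_left[of 0] have "measure M {..<0} = 0"
    by (rule tendsto_unique[rotated]) simp
  then have "{..<0} \<in> null_sets M"
    by (auto simp: null_sets_def emeasure_eq_measure M_is_borel)
  then show "AE x in M. 0 \<le> x"
    by (rule AE_I') auto
qed

lemma (in real_distribution) AE_conv_power_nonneg:
  assumes "AE x in M. 0 \<le> x"
  shows "AE x in conv_power M n. 0 \<le> x"
proof -
  have "cdf (conv_power M n) x = 0" if "x < 0" for x
    using that
  proof (induction n arbitrary: x)
    case 0
    then show ?case by (auto simp: cdf_def measure_return)
  next
    case (Suc n)
    have "(\<integral>y. cdf (conv_power M n) (x - y) \<partial>M) = (\<integral>y. 0 \<partial>M)"
      using assms conv_power_real_distribution[of n]
      by (intro integral_cong_AE borel_measurable_integrable cdf_integrable_reflect)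
         (use Suc in auto)
    then show ?case
      by (simp add: cdf_convolution[OF real_distribution_axioms conv_power_real_distribution])
  qed
  then show ?thesis
    by (simp add: real_distribution.AE_nonneg_iff[OF conv_power_real_distribution])
qed

text \<open>Passing through \<open>convolution M P'\<close>: replacing \<open>P\<close> by
  \<open>P'\<close> costs \<open>e\<close> only where \<open>x \<le> l\<close>, an event of mass at
  most \<open>cdf M u\<close>, and replacing \<open>M\<close> by \<open>M'\<close> costs
  \<open>d\<close>. The factor \<open>cdf M u\<close> is what produces the denominator
  \<open>1 - \<rho> * H u\<close> after summation.\<close>

lemma abs_cdf_convolution_diff_le:
  assumes M: "real_distribution M" "AE x in M. 0 \<le> x"
    and M': "real_distribution M'" "AE x in M'. 0 \<le> x"
    and P: "real_distribution P" "AE x in P. 0 \<le> x"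
    and P': "real_distribution P'" "AE x in P'. 0 \<le> x"
    and d: "\<And>l. 0 \<le> l \<Longrightarrow> l \<le> u \<Longrightarrow> \<bar>cdf M l - cdf M' l\<bar> \<le> d"
    and e: "\<And>l. 0 \<le> l \<Longrightarrow> l \<le> u \<Longrightarrow> \<bar>cdf P l - cdf P' l\<bar> \<le> e"
    and l: "0 \<le> l" "l \<le> u"
  shows "\<bar>cdf (convolution M P) l - cdf (convolution M' P') l\<bar> \<le> cdf M u * e + d"
proof -
  interpret M: real_distribution M by fact
  interpret M': real_distribution M' by fact
  interpret P: real_distribution P by fact
  interpret P': real_distribution P' by fact
  have neg: "cdf Q x = 0" if "real_distribution Q" "AE x in Q. 0 \<le> x" "x < 0" for Q x
    using that real_distribution.AE_nonneg_iff by blast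
  have d0: "0 \<le> d" and e0: "0 \<le> e"
    using d[OF l] e[OF l] by linarith+
  \<comment> \<open>The inserted term is written by conditioning on the first summand in one
    integral and on the second in the other, so that it cancels.\<close>
  have "cdf (convolution M P) l - cdf (convolution M' P') l =
      (\<integral>x. cdf P (l - x) - cdf P' (l - x) \<partial>M) + (\<integral>x. cdf M (l - x) - cdf M' (l - x) \<partial>P')"
    by (simp add: M.cdf_integrable_reflect P'.cdf_integrable_reflect assms
        cdf_convolution[of M P] cdf_convolution[of M P', symmetric]
        cdf_convolution'[of M' P'] cdf_convolution'[of M P', symmetric])
  moreover have "\<bar>\<integral>x. cdf P (l - x) - cdf P' (l - x) \<partial>M\<bar> \<le> cdf M u * e"
  proof -
    \<comment> \<open>For \<open>x > l\<close> both distribution functions vanish at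
      \<open>l - x\<close>, whence the indicator.\<close>
    have "\<bar>\<integral>x. cdf P (l - x) - cdf P' (l - x) \<partial>M\<bar> \<le> (\<integral>x. e * indicator {..l} x \<partial>M)"
    proof (rule order.trans[OF integral_abs_bound], rule integral_mono_AE)
      show "AE x in M. \<bar>cdf P (l - x) - cdf P' (l - x)\<bar> \<le> e * indicator {..l} x"
        using M(2)
      proof eventually_elim
        case (elim x)
        then show ?case
          using e[of "l - x"] l neg[of P "l - x"] neg[of P' "l - x"] P P'
          by (cases "x \<le> l") auto
      qed
    qed (auto intro!: integrable_abs M.cdf_integrable_reflect integrable_mult_right
          integrable_real_indicator simp: P P' M.M_is_borel M.emeasure_eq_measure)
    also have "\<dots> = e * cdf M l"
      by (simp add: cdf_def)
    also have "\<dots> \<le> cdf M u * e"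
      using M.cdf_nondecreasing[of l u] l e0 by (simp add: mult.commute mult_left_mono)
    finally show ?thesis .
  qed
  moreover have "\<bar>\<integral>x. cdf M (l - x) - cdf M' (l - x) \<partial>P'\<bar> \<le> d"
  proof -
    have "\<bar>\<integral>x. cdf M (l - x) - cdf M' (l - x) \<partial>P'\<bar> \<le> (\<integral>x. d \<partial>P')"
    proof (rule order.trans[OF integral_abs_bound], rule integral_mono_AE)
      show "AE x in P'. \<bar>cdf M (l - x) - cdf M' (l - x)\<bar> \<le> d"
        using P'(2)
      proof eventually_elim
        case (elim x)
        then show ?case
          using d[of "l - x"] l neg[of M "l - x"] neg[of M' "l - x"] M M' d0
          by (cases "x \<le> l") auto
      qed
    qed (auto intro!: integrable_abs P'.cdf_integrable_reflect simp: M M')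
    then show ?thesis
      using P'.prob_space by simp
  qed
  ultimately show ?thesis by linarith
qed

text \<open>The weighted partial sums satisfy
  \<open>T N \<le> \<rho> * h * T N + \<rho> * d / (1 - \<rho>)\<close>, which is solved for
  \<open>T N\<close>; one factor \<open>1 - \<rho>\<close> then cancels against the prefactor of
  \<open>psi\<close>.\<close>

lemma discounted_recursion_bound:
  fixes \<rho> h d :: real and e :: "nat \<Rightarrow> real"
  assumes \<rho>: "0 < \<rho>" "\<rho> < 1" and h: "0 \<le> h" "h \<le> 1" and d: "0 \<le> d"
    and e: "e 0 = 0" "\<And>n. 0 \<le> e n" "\<And>n. e (Suc n) \<le> h * e n + d"
  shows "summable (\<lambda>n. \<rho> ^ Suc n * e (Suc n))"
    and "(1 - \<rho>) * (\<Sum>n. \<rho> ^ Suc n * e (Suc n)) \<le> \<rho> / (1 - \<rho> * h) * d"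
proof -
  have rh: "0 < 1 - \<rho> * h"
    using \<rho> h by (smt (verit) mult_left_le)
  define T where "T N = (\<Sum>n<N. \<rho> ^ Suc n * e (Suc n))" for N
  have T: "T N \<le> \<rho> * d / ((1 - \<rho>) * (1 - \<rho> * h))" for N
  proof -
    \<comment> \<open>Since \<open>e 0 = 0\<close>, adding one nonnegative term and shifting the
      index turns the sum on the left into \<open>T N\<close>.\<close>
    have mono: "(\<Sum>n<N. \<rho> ^ n * e n) \<le> T N"
    proof -
      have "(\<Sum>n<N. \<rho> ^ n * e n) \<le> (\<Sum>n<Suc N. \<rho> ^ n * e n)"
        using \<rho> e by simp
      also have "\<dots> = T N"
        by (subst sum.lessThan_Suc_shift) (simp add: T_def e)
      finally show ?thesis .
    qed
    have geo: "(\<Sum>n<N. \<rho> ^ n) \<le> 1 / (1 - \<rho>)"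
      using \<rho> by (simp add: sum_gp_strict divide_right_mono)
    have "T N \<le> (\<Sum>n<N. \<rho> ^ Suc n * (h * e n + d))"
      unfolding T_def using \<rho> e by (intro sum_mono mult_left_mono) auto
    also have "\<dots> = \<rho> * h * (\<Sum>n<N. \<rho> ^ n * e n) + \<rho> * d * (\<Sum>n<N. \<rho> ^ n)"
      by (simp add: sum.distrib sum_distrib_left algebra_simps)
    also have "\<dots> \<le> \<rho> * h * T N + \<rho> * d * (1 / (1 - \<rho>))"
      using mono geo \<rho> h d by (intro add_mono mult_left_mono) auto
    finally have "(1 - \<rho> * h) * T N \<le> \<rho> * d / (1 - \<rho>)"
      by (simp add: algebra_simps)
    then have "T N * ((1 - \<rho>) * (1 - \<rho> * h)) \<le> \<rho> * d"
      using \<rho> by (simp add: pos_le_divide_eq mult_ac)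
    then show ?thesis
      using rh \<rho> by (simp add: pos_le_divide_eq)
  qed
  show s: "summable (\<lambda>n. \<rho> ^ Suc n * e (Suc n))"
    by (rule bounded_imp_summable[where B="\<rho> * d / ((1 - \<rho>) * (1 - \<rho> * h))"])
       (use T \<rho> e in \<open>auto simp: T_def lessThan_Suc_atMost[symmetric] simp del: sum.lessThan_Suc\<close>)
  have "(\<Sum>n. \<rho> ^ Suc n * e (Suc n)) \<le> \<rho> * d / ((1 - \<rho>) * (1 - \<rho> * h))"
    by (rule suminf_le_const[OF s]) (use T in \<open>simp add: T_def\<close>)
  then have "(1 - \<rho>) * (\<Sum>n. \<rho> ^ Suc n * e (Suc n)) \<le> (1 - \<rho>) * (\<rho> * d / ((1 - \<rho>) * (1 - \<rho> * h)))"
    using \<rho> by (intro mult_left_mono) auto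
  then show "(1 - \<rho>) * (\<Sum>n. \<rho> ^ Suc n * e (Suc n)) \<le> \<rho> / (1 - \<rho> * h) * d"
    using \<rho> by simp
qed

text \<open>Induction on \<open>n\<close> with the one-step estimate bounds the distance of the
  \<open>n\<close>-fold convolutions; at \<open>n = 0\<close> both are the point mass at 0. The
  weights of \<open>psi\<close> are then summed by
  \<open>discounted_recursion_bound\<close>.\<close>

lemma abs_psi_diff_le:
  assumes H: "continuous_life_cdf H" and H': "continuous_life_cdf H'"
    and \<rho>: "0 < \<rho>" "\<rho> < 1" and u: "0 \<le> u"
    and d: "\<And>l. 0 \<le> l \<Longrightarrow> l \<le> u \<Longrightarrow> \<bar>H l - H' l\<bar> \<le> d"
  shows "\<bar>psi \<rho> H u - psi \<rho> H' u\<bar> \<le> \<rho> / (1 - \<rho> * H u) * d"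
proof -
  interpret H: continuous_life_cdf H by fact
  interpret H': continuous_life_cdf H' by fact
  let ?P = "conv_power (interval_measure H)" and ?P' = "conv_power (interval_measure H')"
  have M: "AE x in interval_measure H. 0 \<le> x" "AE x in interval_measure H'. 0 \<le> x"
    by (auto simp: H.law.AE_nonneg_iff H.cdf_H H.H_nonpos H'.law.AE_nonneg_iff H'.cdf_H H'.H_nonpos)
  note P = H.law.conv_power_real_distribution H.law.AE_conv_power_nonneg[OF M(1)]
    and P' = H'.law.conv_power_real_distribution H'.law.AE_conv_power_nonneg[OF M(2)]
  have d0: "0 \<le> d"
    using d[of 0] u by linarith
  \<comment> \<open>In closed form, \<open>e n\<close> is \<open>d\<close> times the sum of the
    powers \<open>H u ^ i\<close> over \<open>i < n\<close>.\<close>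
  define e where "e = rec_nat 0 (\<lambda>_ x. H u * x + d)"
  have e: "e 0 = 0" "e (Suc n) = H u * e n + d" for n
    by (auto simp: e_def)
  have e0: "0 \<le> e n" for n
    by (induction n) (auto simp: e d0 H.H_nonneg)
  have diff: "\<bar>cdf (?P n) l - cdf (?P' n) l\<bar> \<le> e n" if "0 \<le> l" "l \<le> u" for n l
    using that
  proof (induction n arbitrary: l)
    case 0
    then show ?case by (simp add: e)
  next
    case (Suc n)
    have "\<bar>cdf (?P (Suc n)) l - cdf (?P' (Suc n)) l\<bar> \<le> cdf (interval_measure H) u * e n + d"
      unfolding conv_power.simps
      by (rule abs_cdf_convolution_diff_le[where u=u])
         (use Suc M P P' d in \<open>auto simp: H.cdf_H H'.cdf_H H.law.real_distribution_axioms
            H'.law.real_distribution_axioms\<close>)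
    then show ?case by (simp add: e H.cdf_H)
  qed
  \<comment> \<open>Domination by the geometric series makes both defining series converge, so that
    they can be subtracted term by term.\<close>
  have sm: "summable (\<lambda>n. \<rho> ^ Suc n * (1 - cdf (Q (Suc n)) u))"
    if "\<And>n. real_distribution (Q n)" for Q :: "nat \<Rightarrow> real measure"
  proof (rule summable_comparison_test'[where g="\<lambda>n. \<rho> ^ Suc n" and N=0])
    show "summable (\<lambda>n. \<rho> ^ Suc n)"
      using \<rho> by (simp add: summable_mult)
    fix n
    interpret Q: real_distribution "Q (Suc n)" by fact
    show "norm (\<rho> ^ Suc n * (1 - cdf (Q (Suc n)) u)) \<le> \<rho> ^ Suc n"
      using \<rho> Q.cdf_nonneg[of u] Q.cdf_bounded_prob[of u]
      by (auto simp: abs_mult intro!: mult_left_le)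
  qed
  note rec = discounted_recursion_bound[of \<rho> "H u" d e, OF \<rho> H.H_nonneg H.H_le_1 d0 e(1) e0]
  have "\<bar>psi \<rho> H u - psi \<rho> H' u\<bar> =
      (1 - \<rho>) * \<bar>\<Sum>n. \<rho> ^ Suc n * (cdf (?P' (Suc n)) u - cdf (?P (Suc n)) u)\<bar>"
    unfolding psi_def right_diff_distrib[symmetric]
    using \<rho> suminf_diff[OF sm[of ?P, OF P(1)] sm[of ?P', OF P'(1)]]
    by (simp add: abs_mult right_diff_distrib[symmetric] del: conv_power.simps power_Suc)
  also have "\<dots> \<le> (1 - \<rho>) * (\<Sum>n. \<rho> ^ Suc n * e (Suc n))"
  proof (rule mult_left_mono)
    have b: "norm (\<rho> ^ Suc n * (cdf (?P' (Suc n)) u - cdf (?P (Suc n)) u)) \<le> \<rho> ^ Suc n * e (Suc n)" for n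
      using diff[of u "Suc n"] u \<rho>
      by (auto simp: abs_mult abs_minus_commute simp del: conv_power.simps power_Suc intro!: mult_left_mono)
    have s: "summable (\<lambda>n. \<rho> ^ Suc n * e (Suc n))"
      by (rule rec(1)) (simp add: e)
    show "\<bar>\<Sum>n. \<rho> ^ Suc n * (cdf (?P' (Suc n)) u - cdf (?P (Suc n)) u)\<bar> \<le> (\<Sum>n. \<rho> ^ Suc n * e (Suc n))"
      using norm_suminf_le[OF b s] by simp
  qed (use \<rho> in simp)
  also have "\<dots> \<le> \<rho> / (1 - \<rho> * H u) * d"
    by (rule rec(2)) (simp add: e)
  finally show ?thesis .
qed

section \<open>Products with a positive random factor\<close>

locale positive_law = real_distribution G for G +
  assumes AE_pos: "AE s in G. 0 < s"
begin

context
  fixes H assumes H: "continuous_life_cdf H"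
begin

interpretation H: continuous_life_cdf H by (rule H)

lemma scaled_H_measurable [measurable]: "(\<lambda>s. H (u / s)) \<in> borel_measurable G"
  by measurable

lemma integrable_scaled_H: "integrable G (\<lambda>s. H (u / s))"
  by (rule integrable_const_bound[where B=1]) (auto simp: H.H_nonneg H.H_le_1)

lemma mellin_conv_eq: "mellin_conv H G u = (\<integral>s. H (u / s) \<partial>G)"
  unfolding mellin_conv_def set_lebesgue_integral_def
  using AE_pos by (intro integral_cong_AE) (auto elim!: eventually_mono)

text \<open>Dominated convergence with the constant bound 1 carries continuity and the limit at
  infinity through the integral; positivity of \<open>s\<close> preserves order under
  division.\<close>

lemma continuous_life_cdf_mellin_conv: "continuous_life_cdf (mellin_conv H G)"
proof
  show "mono (mellin_conv H G)"
  proof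
    fix x y :: real assume "x \<le> y"
    then show "mellin_conv H G x \<le> mellin_conv H G y"
      unfolding mellin_conv_eq using AE_pos
      by (intro integral_mono_AE integrable_scaled_H)
         (auto elim!: eventually_mono intro!: monoD[OF H.mono_H] divide_right_mono)
  qed
  show "isCont (mellin_conv H G) x" for x
    unfolding continuous_at_sequentially
  proof safe
    fix X assume X: "X \<longlonglongrightarrow> x"
    have "(\<lambda>n. \<integral>s. H (X n / s) \<partial>G) \<longlonglongrightarrow> (\<integral>s. H (x / s) \<partial>G)"
    proof (rule integral_dominated_convergence[where w="\<lambda>_. 1"])
      show "AE s in G. (\<lambda>n. H (X n / s)) \<longlonglongrightarrow> H (x / s)"
        using AE_pos
      proof eventually_elim
        case (elim s)
        then have "(\<lambda>n. X n / s) \<longlonglongrightarrow> x / s"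
          using X by (intro tendsto_intros) auto
        then show ?case
          by (rule isCont_tendsto_compose[OF H.cont_H])
      qed
    qed (auto simp: H.H_nonneg H.H_le_1)
    then show "(mellin_conv H G \<circ> X) \<longlonglongrightarrow> mellin_conv H G x"
      by (simp add: comp_def mellin_conv_eq)
  qed
  show "mellin_conv H G x = 0" if "x \<le> 0" for x
  proof -
    have "(\<integral>s. H (x / s) \<partial>G) = (\<integral>s. 0 \<partial>G)"
      using AE_pos that
      by (intro integral_cong_AE) (auto elim!: eventually_mono intro!: H.H_nonpos divide_nonpos_pos)
    then show ?thesis by (simp add: mellin_conv_eq)
  qed
  have "((\<lambda>t. \<integral>s. H (t / s) \<partial>G) \<longlongrightarrow> (\<integral>s. 1 \<partial>G)) at_top"
  proof (rule integral_dominated_convergence_at_top[where w="\<lambda>_. 1"])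
    show "AE s in G. ((\<lambda>t. H (t / s)) \<longlongrightarrow> 1) at_top"
      using AE_pos
    proof eventually_elim
      case (elim s)
      then have "filterlim (\<lambda>t. t / s) at_top at_top"
        using filterlim_tendsto_pos_mult_at_top[OF tendsto_const[of "1 / s"] _ filterlim_ident] by simp
      then show ?case
        by (rule filterlim_compose[OF H.H_lim])
    qed
  qed (auto simp: H.H_nonneg H.H_le_1)
  then show "(mellin_conv H G \<longlongrightarrow> 1) at_top"
    using prob_space by (simp add: mellin_conv_eq[abs_def])
qed

text \<open>As \<open>G\<close> has total mass 1, \<open>H l\<close> is the integral of a constant,
  so the comparison takes place inside the integral. The majorant \<open>g\<close> is a step
  function on shells for the series and a quadratic for the Erlang limit.\<close>

lemma abs_diff_mellin_conv_le:
  assumes "integrable G g" "AE s in G. \<bar>H l - H (l / s)\<bar> \<le> g s"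
  shows "\<bar>H l - mellin_conv H G l\<bar> \<le> (\<integral>s. g s \<partial>G)"
proof -
  have "H l - mellin_conv H G l = (\<integral>s. H l - H (l / s) \<partial>G)"
    using prob_space by (simp add: mellin_conv_eq integrable_scaled_H)
  also have "\<bar>\<dots>\<bar> \<le> (\<integral>s. \<bar>H l - H (l / s)\<bar> \<partial>G)"
    by (rule integral_abs_bound)
  also have "\<dots> \<le> (\<integral>s. g s \<partial>G)"
    using assms by (intro integral_mono_AE integrable_abs) (auto simp: integrable_scaled_H)
  finally show ?thesis .
qed

end

end

section \<open>Nested intervals around 1 and the shell bound\<close>

context
  fixes a b :: "nat \<Rightarrow> ereal"
  assumes shrink: "shrinks_to_one a b"
begin

text \<open>Every interval contains 1 and so is nonempty, which is why inclusion of the intervals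
  gives the order of their end points.\<close>

lemma
  shows shrinks_to_one_bounds: "0 \<le> a k" "a k \<le> 1" "1 \<le> b k"
    and shrinks_to_one_Suc: "a k \<le> a (Suc k)" "b (Suc k) \<le> b k"
proof -
  have 1: "1 \<in> {a k..b k}" for k
    using shrink unfolding shrinks_to_one_def by blast
  then show "a k \<le> 1" "1 \<le> b k" by auto
  have le: "a (Suc k) \<le> b (Suc k)" for k
    using 1[of "Suc k"] by (auto intro: order.trans)
  have "{a (Suc k)..b (Suc k)} \<subseteq> {a k..b k}" for k
    using shrink unfolding shrinks_to_one_def by blast
  then show s: "a k \<le> a (Suc k)" "b (Suc k) \<le> b k" for k
    using le[of k] by auto
  show "0 \<le> a k"
  proof (induction k)
    case 0
    then show ?case using shrink by (simp add: shrinks_to_one_def)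
  next
    case (Suc k)
    then show ?case using s(1) order.trans by blast
  qed
qed

end

text \<open>A difference of distribution functions is the mass of a half-open interval; without
  atoms the left end point adds nothing. Only \<open>b\<close> can be infinite, and there
  \<open>cdf_ext\<close> supplies the total mass 1.\<close>

lemma (in positive_law) interval_mass_eq_measure:
  assumes atomless: "\<And>x. measure G {x} = 0"
    and ab: "0 \<le> a" "a \<le> 1" "1 \<le> b"
  shows "interval_mass G a b = measure G {s. a \<le> ereal s \<and> ereal s \<le> b}"
proof -
  obtain a' where a': "a = ereal a'"
    using ab by (cases a) auto
  show ?thesis
  proof (cases b)
    case (real b')
    have "measure G {..b'} = measure G {..<a'} + measure G {a'..b'}"
      using ab a' real by (subst finite_measure_Union[symmetric]) (auto simp: M_is_borel intro!: arg_cong[where f="measure G"])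
    moreover have "measure G {..a'} = measure G {..<a'} + measure G {a'}"
      by (subst finite_measure_Union[symmetric]) (auto simp: M_is_borel intro!: arg_cong[where f="measure G"])
    ultimately show ?thesis
      using real a' by (simp add: interval_mass_def cdf_ext_def cdf_def atomless atLeastAtMost_def atLeast_def atMost_def Int_def)
  next
    case PInf
    have "measure G UNIV = measure G {..<a'} + measure G {a'..}"
      by (subst finite_measure_Union[symmetric]) (auto simp: M_is_borel intro!: arg_cong[where f="measure G"])
    moreover have "measure G {..a'} = measure G {..<a'} + measure G {a'}"
      by (subst finite_measure_Union[symmetric]) (auto simp: M_is_borel intro!: arg_cong[where f="measure G"])
    ultimately show ?thesis
      using PInf a' prob_space by (simp add: interval_mass_def cdf_ext_def cdf_def atomless atLeast_def)
  qed (use ab in auto)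
qed

text \<open>For every \<open>N\<close>, the integrand is at most \<open>C k\<close> on each shell
  with \<open>k < N\<close> and at most 1 on the core \<open>A N\<close>. The mass of the core tends
  to 0, because the intervals shrink to the point 1, which is not an atom.\<close>

lemma (in positive_law) mellin_conv_diff_le_suminf:
  fixes H :: "real \<Rightarrow> real" and u :: real and a b :: "nat \<Rightarrow> ereal"
  defines "C \<equiv> \<lambda>k. SUP l\<in>{0<..<u}. scaled H (a k) l - scaled H (b k) l"
  defines "m \<equiv> \<lambda>k. interval_mass G (a k) (b k)"
  assumes H: "continuous_life_cdf H" and atomless: "\<And>x. measure G {x} = 0"
    and shrink: "shrinks_to_one a b" and u: "0 < u" and l: "0 \<le> l" "l \<le> u"
  shows "\<bar>H l - mellin_conv H G l\<bar> \<le> (\<Sum>k. C k * (m k - m (Suc k)))"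
proof -
  interpret H: continuous_life_cdf H by fact
  note bounds = shrinks_to_one_bounds[OF shrink] and mono_ab = shrinks_to_one_Suc[OF shrink]
  define A where "A k = {s::real. a k \<le> ereal s \<and> ereal s \<le> b k}" for k
  have A_borel [measurable]: "A k \<in> sets borel" for k
    unfolding A_def by measurable
  have A_sub: "A (Suc k) \<subseteq> A k" for k
    using mono_ab[of k] by (auto simp: A_def intro: order.trans)
  have m: "m k = measure G (A k)" for k
    unfolding m_def A_def by (rule interval_mass_eq_measure[OF atomless bounds])
  have m_mono: "measure G (A (Suc k)) \<le> measure G (A k)" for k
    by (intro finite_measure_mono A_sub) (simp add: M_is_borel)
  have m_lim: "(\<lambda>k. measure G (A k)) \<longlonglongrightarrow> 0"
  proof -
    have "(\<Inter>k. {a k..b k}) = {1}"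
      using shrink by (simp add: shrinks_to_one_def)
    then have "x \<in> (\<Inter>k. A k) \<longleftrightarrow> x = 1" for x
      unfolding A_def by (auto simp: set_eq_iff one_ereal_def)
    then have "(\<Inter>k. A k) = {1}" by blast
    moreover have "range A \<subseteq> events"
      by (auto simp: M_is_borel)
    ultimately show ?thesis
      using finite_Lim_measure_decseq[of A] A_sub atomless[of 1] by (simp add: decseq_Suc_iff)
  qed
  \<comment> \<open>Dividing by a larger \<open>s\<close> decreases the argument of
    \<open>H\<close>; the conventions at 0 and infinity cover the degenerate end points because
    \<open>H\<close> takes values between 0 and 1.\<close>
  have lower: "scaled H (b k) x \<le> H (x / s)" and upper: "H (x / s) \<le> scaled H (a k) x"
    if "s \<in> A k" "0 < s" "0 < x" for s k x
  proof -
    show "scaled H (b k) x \<le> H (x / s)"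
      using that bounds[of k] by (cases "b k")
        (auto simp: scaled_def A_def H.H_nonneg intro!: monoD[OF H.mono_H] divide_left_mono)
    show "H (x / s) \<le> scaled H (a k) x"
      using that bounds[of k] by (cases "a k")
        (auto simp: scaled_def A_def H.H_le_1 intro!: monoD[OF H.mono_H] divide_left_mono)
  qed
  have scaled01: "0 \<le> scaled H r x" "scaled H r x \<le> 1" for r x
    by (auto simp: scaled_def H.H_nonneg H.H_le_1)
  have bdd: "bdd_above ((\<lambda>l. scaled H (a k) l - scaled H (b k) l) ` {0<..<u})" for k
    using scaled01 by (intro bdd_aboveI2[where M=1]) (smt (verit))
  have one: "1 \<in> A k" for k
    using bounds[of k] by (simp add: A_def one_ereal_def)
  have diff_open: "\<bar>H x - H (x / s)\<bar> \<le> C k" if s: "s \<in> A k" "0 < s" and x: "0 < x" "x < u" for s k x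
  proof -
    have "\<bar>H x - H (x / s)\<bar> \<le> scaled H (a k) x - scaled H (b k) x"
      using lower[OF s x(1)] upper[OF s x(1)]
        lower[OF one[of k] zero_less_one x(1)] upper[OF one[of k] zero_less_one x(1)]
      by (simp add: abs_le_iff)
    also have "\<dots> \<le> C k"
      unfolding C_def by (rule cSUP_upper[OF _ bdd]) (use x in auto)
    finally show ?thesis .
  qed
  \<comment> \<open>Any interior point, here \<open>u/2\<close> with \<open>s = 1\<close>, shows
    that the supremum is nonnegative.\<close>
  have C0: "0 \<le> C k" for k
    using diff_open[OF one[of k], of "u/2"] u by auto
  have C1: "C k \<le> 1" for k
    unfolding C_def using u scaled01 by (intro cSUP_least) (auto, smt (verit))
  have diff: "\<bar>H l - H (l / s)\<bar> \<le> C k" if s: "s \<in> A k" "0 < s" for s k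
  proof -
    consider "l = 0" | "0 < l" "l < u" | "l = u" using l by linarith
    then show ?thesis
    proof cases
      \<comment> \<open>The supremum runs over the open interval only; by continuity the bound
        passes to \<open>l = u\<close> as a limit from the left.\<close>
      case 3
      have "((\<lambda>x. \<bar>H x - H (x / s)\<bar>) \<longlongrightarrow> \<bar>H l - H (l / s)\<bar>) (at_left l)"
        using s by (intro tendsto_intros isCont_tendsto_compose[OF H.cont_H]) auto
      moreover have "\<forall>\<^sub>F x in at_left l. \<bar>H x - H (x / s)\<bar> \<le> C k"
        using eventually_at_left_real[of 0 l] 3 u
        by (auto intro!: diff_open s elim!: eventually_mono)
      ultimately show ?thesis
        by (rule tendsto_upperbound) simp
    qed (use diff_open[OF s] C0 in auto)
  qed
  define t where "t k = C k * (measure G (A k) - measure G (A (Suc k)))" for k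
  have t0: "0 \<le> t k" for k
    using C0 m_mono by (simp add: t_def)
  have finite_bound: "\<bar>H l - mellin_conv H G l\<bar> \<le> (\<Sum>k<N. t k) + measure G (A N)" for N
  proof -
    \<comment> \<open>The difference of indicators is the indicator of the \<open>k\<close>-th
      shell; the last term pays 1 on the core.\<close>
    define g where "g N s = (\<Sum>k<N. C k * (indicator (A k) s - indicator (A (Suc k)) s)) + indicator (A N) s"
      for N and s :: real
    have g_nonneg: "0 \<le> (\<Sum>k<N. C k * (indicator (A k) s - indicator (A (Suc k)) s :: real))" for N s
      using C0 A_sub by (intro sum_nonneg mult_nonneg_nonneg) (auto simp: indicator_def)
    have out: "\<bar>H l - H (l / s)\<bar> \<le> (\<Sum>k<N. C k * (indicator (A k) s - indicator (A (Suc k)) s))"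
      if "0 < s" "s \<notin> A N" for s
      using that(2)
    proof (induction N)
      \<comment> \<open>\<open>A 0\<close> consists of all nonnegative reals, so no positive
        \<open>s\<close> lies outside it.\<close>
      case 0
      then show ?case
        using that(1) shrink by (auto simp: A_def shrinks_to_one_def)
    next
      case (Suc N)
      then show ?case
        using diff[of s N] g_nonneg[of s N] that(1) by (cases "s \<in> A N") auto
    qed
    have int_ind: "integrable G (indicator (A k) :: real \<Rightarrow> real)" for k
      by (auto simp: M_is_borel emeasure_eq_measure)
    have "\<bar>H l - mellin_conv H G l\<bar> \<le> (\<integral>s. g N s \<partial>G)"
    proof (rule abs_diff_mellin_conv_le[OF H])
      show "integrable G (g N)"
        unfolding g_def using int_ind by (intro Bochner_Integration.integrable_add Bochner_Integration.integrable_sum integrable_mult_right Bochner_Integration.integrable_diff)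
      show "AE s in G. \<bar>H l - H (l / s)\<bar> \<le> g N s"
        using AE_pos
      proof eventually_elim
        case (elim s)
        then show ?case
          using out[of s] g_nonneg[of s N] H.abs_H_diff_le_1[of l "l / s"]
          by (cases "s \<in> A N") (auto simp: g_def)
      qed
    qed
    also have "\<dots> = (\<Sum>k<N. t k) + measure G (A N)"
      unfolding g_def t_def using int_ind by simp
    finally show ?thesis .
  qed
  have summable: "summable t"
  proof (rule bounded_imp_summable[where B=1])
    fix n
    \<comment> \<open>As \<open>C k \<le> 1\<close>, the partial sums are dominated by a telescoping
      sum of masses.\<close>
    have "(\<Sum>k\<le>n. t k) \<le> (\<Sum>k<Suc n. measure G (A k) - measure G (A (Suc k)))"
      unfolding lessThan_Suc_atMost[symmetric] t_def
      using C0 C1 m_mono by (intro sum_mono mult_left_le_one_le) auto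
    also have "\<dots> = measure G (A 0) - measure G (A (Suc n))"
      by (rule sum_lessThan_telescope')
    also have "\<dots> \<le> 1"
      using prob_le_1[of "A 0"] measure_nonneg[of G "A (Suc n)"] by linarith
    finally show "(\<Sum>k\<le>n. t k) \<le> 1" .
  qed (rule t0)
  have "(\<lambda>N. (\<Sum>k<N. t k) + measure G (A N)) \<longlonglongrightarrow> suminf t + 0"
    by (intro tendsto_add summable_LIMSEQ summable m_lim)
  then have "\<bar>H l - mellin_conv H G l\<bar> \<le> suminf t + 0"
    by (rule LIMSEQ_le_const) (use finite_bound in blast)
  then show ?thesis
    by (simp add: t_def[abs_def] m)
qed

text \<open>For large \<open>l\<close> the point \<open>l / s\<close> need not be close to
  \<open>l\<close>. Beyond \<open>2 * X\<close> both points lie where \<open>H\<close> exceeds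
  \<open>1 - \<epsilon>\<close>; up to there the displacement is at most
  \<open>4 * X * \<delta>\<close>, which the Lipschitz bound controls.\<close>

lemma (in continuous_life_cdf) scaling_modulus:
  assumes lip: "\<And>x y. \<bar>H x - H y\<bar> \<le> B * \<bar>x - y\<bar>" and \<epsilon>: "0 < \<epsilon>"
  obtains \<delta> where "0 < \<delta>" "\<And>l s. 0 \<le> l \<Longrightarrow> 0 < s \<Longrightarrow> \<bar>s - 1\<bar> \<le> \<delta> \<Longrightarrow> \<bar>H l - H (l / s)\<bar> \<le> \<epsilon>"
proof -
  have "\<forall>\<^sub>F x in at_top. 1 - \<epsilon> < H x"
    using \<epsilon> by (intro order_tendstoD(1)[OF H_lim]) auto
  then obtain X0 where X0: "\<And>x. X0 \<le> x \<Longrightarrow> 1 - \<epsilon> < H x"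
    by (auto simp: eventually_at_top_linorder)
  define X where "X = max 1 X0"
  have X: "1 \<le> X" "\<And>x. X \<le> x \<Longrightarrow> 1 - \<epsilon> < H x"
    using X0 by (auto simp: X_def)
  have B: "0 \<le> B"
    using lip[of 1 0] by simp
  \<comment> \<open>The bound \<open>1/2\<close> keeps \<open>s\<close> between \<open>1/2\<close>
    and \<open>2\<close>, as used for dividing by \<open>s\<close> and for
    \<open>X \<le> l / s\<close>. Taking \<open>B + 1\<close> keeps the denominator positive when
    \<open>B = 0\<close>.\<close>
  define \<delta> where "\<delta> = min (1/2) (\<epsilon> / (4 * X * (B + 1)))"
  have \<delta>: "0 < \<delta>" "\<delta> \<le> 1/2" "4 * X * (B + 1) * \<delta> \<le> \<epsilon>"
  proof -
    show "0 < \<delta>" "\<delta> \<le> 1/2"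
      using \<epsilon> X(1) B by (auto simp: \<delta>_def)
    have "\<delta> \<le> \<epsilon> / (4 * X * (B + 1))" by (simp add: \<delta>_def)
    then show "4 * X * (B + 1) * \<delta> \<le> \<epsilon>"
      using X(1) B by (subst (asm) pos_le_divide_eq) (auto simp: mult_ac)
  qed
  show thesis
  proof
    fix l s :: real
    assume l: "0 \<le> l" and s: "0 < s" "\<bar>s - 1\<bar> \<le> \<delta>"
    show "\<bar>H l - H (l / s)\<bar> \<le> \<epsilon>"
    proof (cases "l \<le> 2 * X")
      case True
      have "l - l / s = l * (s - 1) / s"
        using s by (simp add: field_simps)
      then have "\<bar>l - l / s\<bar> = l * \<bar>s - 1\<bar> / s"
        using l s by (simp add: abs_mult)
      also have "\<dots> \<le> (2 * X) * \<delta> / (1/2)"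
        using True l s \<delta> X by (intro frac_le mult_mono) auto
      finally have "B * \<bar>l - l / s\<bar> \<le> (B + 1) * (4 * X * \<delta>)"
        using B by (intro mult_mono) auto
      with lip[of l "l / s"] \<delta>(3) show ?thesis
        by (simp add: mult_ac)
    next
      case False
      have "X \<le> l / s"
      proof -
        have "X * s \<le> X * 2"
          using s \<delta> X(1) by (intro mult_left_mono) auto
        then show ?thesis
          using False s by (simp add: pos_le_divide_eq)
      qed
      then show ?thesis
        using X(2)[of l] X(2)[of "l / s"] False X(1) H_le_1[of l] H_le_1[of "l / s"] by auto
    qed
  qed (rule \<delta>(1))
qed

section \<open>Integrated tails\<close>

text \<open>Layer-cake formula: \<open>x\<close> is the length of \<open>{0..<x}\<close>, and
  Tonelli exchanges the two integrals. Nonnegative integrals yield integrability together with the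
  value.\<close>

lemma (in real_distribution)
  assumes nonneg: "AE x in M. 0 \<le> x" and int: "integrable M (\<lambda>x. x)"
  shows set_integrable_tail: "set_integrable lborel {0..} (\<lambda>t. 1 - cdf M t)"
    and set_integral_tail: "(LBINT t:{0..}. 1 - cdf M t) = mean M"
proof -
  interpret pair_sigma_finite M lborel ..
  have tail: "emeasure M {t<..} = ennreal (1 - cdf M t)" for t
  proof -
    have "{t<..} = space M - {..t}" by auto
    then show ?thesis
      using prob_compl[of "{..t}"] by (simp add: emeasure_eq_measure cdf_def M_is_borel)
  qed
  have meas: "(\<lambda>p. indicator {0..} (snd p) * indicator {p. snd p < fst p} p :: ennreal)
      \<in> borel_measurable (M \<Otimes>\<^sub>M lborel)"
  proof -
    have [measurable_cong]: "sets M = sets borel" by (rule M_is_borel)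
    show ?thesis by measurable
  qed
  have "ennreal (mean M) = (\<integral>\<^sup>+x. ennreal x \<partial>M)"
    unfolding mean_def using nn_integral_eq_integral[OF int nonneg] by simp
  also have "\<dots> = (\<integral>\<^sup>+x. \<integral>\<^sup>+t. indicator {0..} t * indicator {p. snd p < fst p} (x, t) \<partial>lborel \<partial>M)"
    using nonneg
  proof (intro nn_integral_cong_AE, eventually_elim)
    case (elim x)
    have "(\<integral>\<^sup>+t. indicator {0..} t * indicator {p. snd p < fst p} (x, t) \<partial>lborel) =
        (\<integral>\<^sup>+t. indicator {0..<x} t \<partial>lborel)"
      by (intro nn_integral_cong) (auto split: split_indicator)
    then show ?case using elim by simp
  qed
  also have "\<dots> = (\<integral>\<^sup>+t. \<integral>\<^sup>+x. indicator {0..} t * indicator {p. snd p < fst p} (x, t) \<partial>M \<partial>lborel)"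
    by (rule Fubini'[symmetric]) (use meas in \<open>simp add: split_beta'\<close>)
  also have "\<dots> = (\<integral>\<^sup>+t. ennreal (indicator {0..} t *\<^sub>R (1 - cdf M t)) \<partial>lborel)"
  proof (intro nn_integral_cong)
    fix t :: real
    have "(\<integral>\<^sup>+x. indicator {0..} t * indicator {p. snd p < fst p} (x, t) \<partial>M) =
        (\<integral>\<^sup>+x. indicator {0..} t * indicator {t<..} x \<partial>M)"
      by (intro nn_integral_cong) (auto split: split_indicator)
    also have "\<dots> = indicator {0..} t * emeasure M {t<..}"
      by (subst nn_integral_cmult) (auto simp: M_is_borel)
    finally show "(\<integral>\<^sup>+x. indicator {0..} t * indicator {p. snd p < fst p} (x, t) \<partial>M) =
        ennreal (indicator {0..} t *\<^sub>R (1 - cdf M t))"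
      by (auto simp: tail split: split_indicator)
  qed
  finally have eq: "(\<integral>\<^sup>+t. ennreal (indicator {0..} t *\<^sub>R (1 - cdf M t)) \<partial>lborel) = ennreal (mean M)" ..
  have mb: "cdf M \<in> borel_measurable borel"
    by (rule borel_measurable_mono) (auto intro!: monoI cdf_nondecreasing)
  have "0 \<le> mean M"
    unfolding mean_def using nonneg by (rule integral_nonneg_AE)
  then have "has_bochner_integral lborel (\<lambda>t. indicator {0..} t *\<^sub>R (1 - cdf M t)) (mean M)"
    using mb by (intro has_bochner_integral_nn_integral eq)
      (auto simp: cdf_bounded_prob)
  then show "set_integrable lborel {0..} (\<lambda>t. 1 - cdf M t)"
    and "(LBINT t:{0..}. 1 - cdf M t) = mean M"
    by (auto simp: set_integrable_def set_lebesgue_integral_def has_bochner_integral_iff)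
qed

context
  fixes F :: "real measure"
  assumes F: "real_distribution F" "AE x in F. 0 \<le> x"
    and int_F: "integrable F (\<lambda>x. x)" and mean_pos: "0 < mean F"
begin

interpretation F: real_distribution F by (rule F)

lemma integrated_tail_nonpos: "u \<le> 0 \<Longrightarrow> integrated_tail F u = 0"
proof -
  assume "u \<le> 0"
  \<comment> \<open>At \<open>u = 0\<close> the domain is the single point 0, a null set; for
    \<open>u < 0\<close> it is empty.\<close>
  have "AE t in lborel. indicator {0..u} t *\<^sub>R (1 - cdf F t) = 0"
    using AE_lborel_singleton[of "0::real"] by eventually_elim (use \<open>u \<le> 0\<close> in auto)
  then have "(LBINT t:{0..u}. 1 - cdf F t) = 0"
    unfolding set_lebesgue_integral_def by (rule integral_eq_zero_AE)
  then show ?thesis by (simp add: integrated_tail_def)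
qed

text \<open>The integrand lies between 0 and 1. Negative arguments reduce to nonnegative ones, since
  the function vanishes up to 0.\<close>

lemma integrated_tail_increment:
  assumes "u \<le> v"
  shows "0 \<le> integrated_tail F v - integrated_tail F u"
    and "integrated_tail F v - integrated_tail F u \<le> (v - u) / mean F"
proof -
  have pos: "0 \<le> integrated_tail F v - integrated_tail F u \<and>
      integrated_tail F v - integrated_tail F u \<le> (v - u) / mean F" if "0 \<le> u" "u \<le> v" for u v
  proof -
    have si: "set_integrable lborel S (\<lambda>t. 1 - cdf F t)" if "S \<subseteq> {0..}" "S \<in> sets borel" for S
      using F.set_integrable_tail[OF F(2) int_F] that by (auto elim: set_integrable_subset)
    have "(LBINT t:{0..u} \<union> {u<..v}. 1 - cdf F t) =
        (LBINT t:{0..u}. 1 - cdf F t) + (LBINT t:{u<..v}. 1 - cdf F t)"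
      using that by (intro set_integral_Un si) auto
    moreover have "{0..u} \<union> {u<..v} = {0..v}" using that by auto
    ultimately have eq: "integrated_tail F v - integrated_tail F u = (LBINT t:{u<..v}. 1 - cdf F t) / mean F"
      by (simp add: integrated_tail_def diff_divide_distrib[symmetric])
    have "0 \<le> (LBINT t:{u<..v}. 1 - cdf F t)"
      unfolding set_lebesgue_integral_def by (rule Bochner_Integration.integral_nonneg) (simp add: F.cdf_bounded_prob)
    moreover have "(LBINT t:{u<..v}. 1 - cdf F t) \<le> (LBINT t:{u<..v}. 1)"
      using that by (intro set_integral_mono si) (auto simp: F.cdf_nonneg set_integrable_def)
    moreover have "(LBINT t:{u<..v}. 1 :: real) = v - u"
      using that by (simp add: set_integral_const)
    ultimately show ?thesis
      using mean_pos by (simp add: eq divide_right_mono)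
  qed
  have "0 \<le> integrated_tail F v - integrated_tail F u \<and>
      integrated_tail F v - integrated_tail F u \<le> (v - u) / mean F"
  proof -
    consider "v \<le> 0" | "u \<le> 0" "0 \<le> v" | "0 \<le> u" using assms by linarith
    then show ?thesis
    proof cases
      case 1
      then show ?thesis using assms mean_pos by (simp add: integrated_tail_nonpos)
    next
      case 2
      have "(v - 0) / mean F \<le> (v - u) / mean F"
        using 2 mean_pos by (intro divide_right_mono) auto
      then show ?thesis
        using pos[of 0 v] 2 by (simp add: integrated_tail_nonpos)
    next
      case 3
      then show ?thesis using pos assms by blast
    qed
  qed
  then show "0 \<le> integrated_tail F v - integrated_tail F u"
    and "integrated_tail F v - integrated_tail F u \<le> (v - u) / mean F" by auto
qed

lemma integrated_tail_Lipschitz: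
  "\<bar>integrated_tail F x - integrated_tail F y\<bar> \<le> 1 / mean F * \<bar>x - y\<bar>"
  using integrated_tail_increment[of x y] integrated_tail_increment[of y x]
  by (cases "x \<le> y") auto

text \<open>The limit 1 at infinity is the tail formula for the mean, divided by the mean;
  continuity is the Lipschitz bound.\<close>

lemma continuous_life_cdf_integrated_tail: "continuous_life_cdf (integrated_tail F)"
proof
  show "mono (integrated_tail F)"
    using integrated_tail_increment(1) by (intro monoI) (simp add: le_diff_eq)
  have "(1 / mean F)-lipschitz_on UNIV (integrated_tail F)"
    using mean_pos integrated_tail_Lipschitz by (intro lipschitz_onI) (auto simp: dist_real_def)
  then show "isCont (integrated_tail F) x" for x
    using lipschitz_on_continuous_on continuous_on_eq_continuous_at by blast
  show "integrated_tail F x = 0" if "x \<le> 0" for x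
    using that by (rule integrated_tail_nonpos)
  have "((\<lambda>b. LBINT t:{0..b}. 1 - cdf F t) \<longlongrightarrow> (LBINT t:{0..}. 1 - cdf F t)) at_top"
    by (intro tendsto_set_lebesgue_integral_at_top F.set_integrable_tail[OF F(2) int_F]) auto
  then have "((\<lambda>b. (LBINT t:{0..b}. 1 - cdf F t) / mean F) \<longlongrightarrow> mean F / mean F) at_top"
    using mean_pos unfolding F.set_integral_tail[OF F(2) int_F] by (intro tendsto_intros) auto
  then show "(integrated_tail F \<longlongrightarrow> 1) at_top"
    using mean_pos by (simp add: integrated_tail_def[abs_def])
qed

end

section \<open>Erlang laws\<close>

lemma Erlang_eq: "Erlang n = density lborel (erlang_density (n - 1) (real n))"
  by (simp add: Erlang_def)

context
  fixes n :: nat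
  assumes n: "1 \<le> n"
begin

interpretation prob_space "Erlang n"
  unfolding Erlang_eq using n by (intro prob_space_erlang_density) auto

text \<open>The identity as a random variable on the law itself, the form to which the Erlang moment
  and variance formulas apply.\<close>

lemma distributed_Erlang: "distributed (Erlang n) lborel (\<lambda>x. x) (erlang_density (n - 1) (real n))"
  unfolding distributed_def Erlang_eq
  by (auto simp: distr_id2)

lemma AE_Erlang_pos: "AE s in Erlang n. 0 < s"
proof -
  have "AE s in lborel. s \<noteq> (0::real)"
    by (rule AE_lborel_singleton)
  then show ?thesis
    unfolding Erlang_eq
    by (subst AE_density) (auto simp: erlang_density_def elim!: eventually_mono)
qed

lemma measure_Erlang_singleton: "measure (Erlang n) {x} = 0"
proof -
  have "emeasure (Erlang n) {x} = 0"
    unfolding Erlang_eq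
    by (subst emeasure_density) (auto simp: nn_integral_0_iff_AE intro!: AE_I'[of "{x}"])
  then show ?thesis by (simp add: measure_def)
qed

lemma Erlang_real_distribution: "real_distribution (Erlang n)"
  by unfold_locales (simp_all add: Erlang_eq)

text \<open>Equal shape and rate make the mean 1, so the second moment about 1 is the variance
  \<open>real n / (real n)\<^sup>2\<close>.\<close>

lemma Erlang_second_moment:
  shows "integrable (Erlang n) (\<lambda>s. (s - 1)\<^sup>2)"
    and "(\<integral>s. (s - 1)\<^sup>2 \<partial>Erlang n) = 1 / real n"
proof -
  have n0: "0 < real n" using n by simp
  note mom = erlang_ith_moment_integrable[OF n0 distributed_Erlang]
  have "(\<lambda>s. (s - 1)\<^sup>2) = (\<lambda>s::real. s ^ 2 - 2 * s ^ 1 + 1)"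
    by (auto simp: power2_eq_square algebra_simps)
  then show "integrable (Erlang n) (\<lambda>s. (s - 1)\<^sup>2)"
    using mom[of 1] mom[of 2] by simp
  have "expectation (\<lambda>s. s ^ 1) = fact (n - 1 + 1) / (fact (n - 1) * real n ^ 1)"
    by (rule erlang_ith_moment[OF n0 distributed_Erlang])
  \<comment> \<open>The case split removes the truncated subtraction in
    \<open>n - 1\<close>.\<close>
  also have "\<dots> = 1"
    using n by (cases n) (simp_all del: of_nat_Suc)
  finally have mean: "expectation (\<lambda>s. s) = 1"
    by (simp only: power_one_right)
  have "(\<integral>s. (s - 1)\<^sup>2 \<partial>Erlang n) = real (n - 1 + 1) / (real n)\<^sup>2"
    using erlang_distributed_variance[OF n0 distributed_Erlang] unfolding mean .
  also have "\<dots> = 1 / real n"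
    using n by (simp add: power2_eq_square)
  finally show "(\<integral>s. (s - 1)\<^sup>2 \<partial>Erlang n) = 1 / real n" .
qed

end

lemma positive_law_Erlang: "1 \<le> n \<Longrightarrow> positive_law (Erlang n)"
  by (simp add: positive_law_def positive_law_axioms_def Erlang_real_distribution AE_Erlang_pos)

text \<open>Chebyshev's inequality: off \<open>\<bar>s - 1\<bar> \<le> \<delta>\<close> the integrand is at most
  \<open>1 \<le> (s - 1)\<^sup>2 / \<delta>\<^sup>2\<close>, and \<open>Erlang n\<close> has variance \<open>1 / n\<close>.\<close>

lemma mellin_conv_Erlang_diff_le:
  assumes H: "continuous_life_cdf H" and n: "1 \<le> n" and \<delta>: "0 < \<delta>" and \<epsilon>: "0 \<le> \<epsilon>"
    and modulus: "\<And>s. 0 < s \<Longrightarrow> \<bar>s - 1\<bar> \<le> \<delta> \<Longrightarrow> \<bar>H l - H (l / s)\<bar> \<le> \<epsilon>"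
  shows "\<bar>H l - mellin_conv H (Erlang n) l\<bar> \<le> \<epsilon> + 1 / (real n * \<delta>\<^sup>2)"
proof -
  interpret H: continuous_life_cdf H by fact
  interpret G: positive_law "Erlang n" by (rule positive_law_Erlang[OF n])
  note moment = Erlang_second_moment[OF n]
  have "\<bar>H l - mellin_conv H (Erlang n) l\<bar> \<le> (\<integral>s. \<epsilon> + (s - 1)\<^sup>2 / \<delta>\<^sup>2 \<partial>Erlang n)"
  proof (rule G.abs_diff_mellin_conv_le[OF H])
    show "integrable (Erlang n) (\<lambda>s. \<epsilon> + (s - 1)\<^sup>2 / \<delta>\<^sup>2)"
      using moment(1) by simp
    show "AE s in Erlang n. \<bar>H l - H (l / s)\<bar> \<le> \<epsilon> + (s - 1)\<^sup>2 / \<delta>\<^sup>2"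
      using G.AE_pos
    proof eventually_elim
      case (elim s)
      show ?case
      proof (cases "\<bar>s - 1\<bar> \<le> \<delta>")
        case True
        have "0 \<le> (s - 1)\<^sup>2 / \<delta>\<^sup>2" by simp
        with modulus[OF elim True] show ?thesis by linarith
      next
        case False
        then have "\<delta>\<^sup>2 \<le> (s - 1)\<^sup>2"
          using \<delta> by (simp add: abs_le_square_iff[symmetric])
        then have "1 \<le> (s - 1)\<^sup>2 / \<delta>\<^sup>2"
          using \<delta> by simp
        with H.abs_H_diff_le_1[of l "l / s"] \<epsilon> show ?thesis by linarith
      qed
    qed
  qed
  also have "\<dots> = \<epsilon> + 1 / (real n * \<delta>\<^sup>2)"
    using moment G.prob_space by simp
  finally show ?thesis .
qed

text \<open>The stability estimate is applied with \<open>d = 2 * \<epsilon>\<close>, one half from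
  the modulus near \<open>s = 1\<close> and one from the variance once \<open>\<xi> m\<close> is
  large. Neither depends on \<open>l\<close> or \<open>u\<close>, and the prefactor is at most
  \<open>1 / (1 - \<rho>)\<close>, so the convergence is uniform.\<close>

lemma uniform_limit_psi_mellin_conv_Erlang:
  assumes H: "continuous_life_cdf H" and lip: "\<And>x y. \<bar>H x - H y\<bar> \<le> B * \<bar>x - y\<bar>"
    and \<rho>: "0 < \<rho>" "\<rho> < 1"
    and \<xi>: "\<And>m. 1 \<le> \<xi> m" "filterlim \<xi> at_top sequentially"
  shows "uniform_limit {0..} (\<lambda>m. psi \<rho> (mellin_conv H (Erlang (\<xi> m)))) (psi \<rho> H) sequentially"
proof (rule uniform_limitI)
  fix e :: real assume "0 < e"
  interpret H: continuous_life_cdf H by fact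
  \<comment> \<open>The final bound is \<open>2 * \<epsilon> / (1 - \<rho>)\<close>, that is, two
    thirds of \<open>e\<close>.\<close>
  define \<epsilon> where "\<epsilon> = e * (1 - \<rho>) / 3"
  have \<epsilon>: "0 < \<epsilon>"
    using \<open>0 < e\<close> \<rho> by (simp add: \<epsilon>_def)
  obtain \<delta> where \<delta>: "0 < \<delta>"
    "\<And>l s. 0 \<le> l \<Longrightarrow> 0 < s \<Longrightarrow> \<bar>s - 1\<bar> \<le> \<delta> \<Longrightarrow> \<bar>H l - H (l / s)\<bar> \<le> \<epsilon>"
    using H.scaling_modulus[OF lip \<epsilon>] by blast
  \<comment> \<open>From this threshold on, the variance term
    \<open>1 / (real (\<xi> m) * \<delta>\<^sup>2)\<close> is at most
    \<open>\<epsilon>\<close>.\<close>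
  have "\<forall>\<^sub>F m in sequentially. nat \<lceil>1 / (\<epsilon> * \<delta>\<^sup>2)\<rceil> \<le> \<xi> m"
    using \<xi>(2) unfolding filterlim_at_top by blast
  then show "\<forall>\<^sub>F m in sequentially.
      \<forall>u\<in>{0..}. dist (psi \<rho> (mellin_conv H (Erlang (\<xi> m))) u) (psi \<rho> H u) < e"
  proof eventually_elim
    case (elim m)
    interpret G: positive_law "Erlang (\<xi> m)" by (rule positive_law_Erlang[OF \<xi>(1)])
    have "1 / (\<epsilon> * \<delta>\<^sup>2) \<le> real (\<xi> m)"
      using elim by linarith
    then have small: "1 / (real (\<xi> m) * \<delta>\<^sup>2) \<le> \<epsilon>"
      using \<epsilon> \<delta>(1) \<xi>(1)[of m] by (simp add: field_simps)
    show ?case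
    proof
      fix u :: real assume "u \<in> {0..}"
      have "\<bar>H l - mellin_conv H (Erlang (\<xi> m)) l\<bar> \<le> 2 * \<epsilon>" if "0 \<le> l" for l
      proof -
        have "\<bar>H l - mellin_conv H (Erlang (\<xi> m)) l\<bar> \<le> \<epsilon> + 1 / (real (\<xi> m) * \<delta>\<^sup>2)"
          using \<epsilon> \<delta> that by (intro mellin_conv_Erlang_diff_le[OF H \<xi>(1)]) auto
        with small show ?thesis by linarith
      qed
      then have "\<bar>psi \<rho> H u - psi \<rho> (mellin_conv H (Erlang (\<xi> m))) u\<bar> \<le> \<rho> / (1 - \<rho> * H u) * (2 * \<epsilon>)"
        using \<open>u \<in> {0..}\<close>
        by (intro abs_psi_diff_le[OF H G.continuous_life_cdf_mellin_conv[OF H] \<rho>]) auto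
      also have "\<dots> \<le> 1 / (1 - \<rho>) * (2 * \<epsilon>)"
        using \<rho> \<epsilon> H.H_le_1[of u] by (intro mult_right_mono frac_le) (auto simp: mult_left_le)
      also have "\<dots> < e"
        using \<open>0 < e\<close> \<rho> by (simp add: \<epsilon>_def field_simps)
      finally show "dist (psi \<rho> (mellin_conv H (Erlang (\<xi> m))) u) (psi \<rho> H u) < e"
        by (simp add: dist_real_def abs_minus_commute)
    qed
  qed
qed

theorem theorem4p3:
  fixes \<rho> :: real and F :: "real measure" and \<xi> :: "nat \<Rightarrow> nat"
  assumes "0 < \<rho>" "\<rho> < 1"
    and "real_distribution F" "AE x in F. 0 \<le> x"
    and "integrable F (\<lambda>x. x)" "0 < mean F"
    and "\<And>m. 1 \<le> \<xi> m"
  shows "(\<forall>(a :: nat \<Rightarrow> ereal) (b :: nat \<Rightarrow> ereal) (m :: nat) (u :: real).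
            shrinks_to_one a b \<longrightarrow> 0 < u \<longrightarrow>
            \<bar>psi \<rho> (integrated_tail F) u
               - psi \<rho> (mellin_conv (integrated_tail F) (Erlang (\<xi> m))) u\<bar>
            \<le> \<rho> / (1 - \<rho> * integrated_tail F u)
               * (\<Sum>k. (SUP l\<in>{0<..<u}. scaled (integrated_tail F) (a k) l
                                        - scaled (integrated_tail F) (b k) l)
                      * (interval_mass (Erlang (\<xi> m)) (a k) (b k)
                         - interval_mass (Erlang (\<xi> m)) (a (Suc k)) (b (Suc k)))))
       \<and> (ac_bounded_density (integrated_tail F) \<longrightarrow>
          filterlim \<xi> at_top sequentially \<longrightarrow>
          uniform_limit {0..}
            (\<lambda>m. psi \<rho> (mellin_conv (integrated_tail F) (Erlang (\<xi> m))))
            (psi \<rho> (integrated_tail F)) sequentially)"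
proof (intro conjI allI impI)
  have H: "continuous_life_cdf (integrated_tail F)"
    by (rule continuous_life_cdf_integrated_tail) fact+
  fix a b :: "nat \<Rightarrow> ereal" and m :: nat and u :: real
  assume shrink: "shrinks_to_one a b" and "0 < u"
  have \<xi>: "1 \<le> \<xi> m" by fact
  interpret G: positive_law "Erlang (\<xi> m)" by (rule positive_law_Erlang[OF \<xi>])
  \<comment> \<open>The series serves as \<open>d\<close> in the stability estimate, since it bounds
    the difference for all \<open>l\<close> in \<open>{0..u}\<close> at once.\<close>
  show "\<bar>psi \<rho> (integrated_tail F) u
               - psi \<rho> (mellin_conv (integrated_tail F) (Erlang (\<xi> m))) u\<bar>
            \<le> \<rho> / (1 - \<rho> * integrated_tail F u)
               * (\<Sum>k. (SUP l\<in>{0<..<u}. scaled (integrated_tail F) (a k) l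
                                        - scaled (integrated_tail F) (b k) l)
                      * (interval_mass (Erlang (\<xi> m)) (a k) (b k)
                         - interval_mass (Erlang (\<xi> m)) (a (Suc k)) (b (Suc k))))"
    using \<open>0 < u\<close>
    by (intro abs_psi_diff_le[OF H G.continuous_life_cdf_mellin_conv[OF H] \<open>0 < \<rho>\<close> \<open>\<rho> < 1\<close>]
        G.mellin_conv_diff_le_suminf[OF H measure_Erlang_singleton[OF \<xi>] shrink]) auto
next
  assume "filterlim \<xi> at_top sequentially"
  then show "uniform_limit {0..}
            (\<lambda>m. psi \<rho> (mellin_conv (integrated_tail F) (Erlang (\<xi> m))))
            (psi \<rho> (integrated_tail F)) sequentially"
    using assms
    by (intro uniform_limit_psi_mellin_conv_Erlang[where B="1 / mean F"] integrated_tail_Lipschitz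
        continuous_life_cdf_integrated_tail)
qed

end
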